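(* Let $\phi:\mathfrak g\to\mathrm{Der}(\mathfrak h)$ be an action of a Lie algebra $\mathfrak g$ on a Lie algebra $\mathfrak h$, and let $B:\mathfrak h\to\mathfrak g$ be a relative Rota-Baxter operator (of weight $1$) on $\mathfrak g$ with respect to $(\mathfrak h;\phi)$. If two one-parameter infinitesimal deformations $B^1_t=B+t\hat B_1$ and $B^2_t=B+t\hat B_2$ of $B$ are equivalent, then $\hat B_1$ and $\hat B_2$ are in the same cohomology class of the second cohomology group $H^2(B)$.
   Context: All Lie algebras are over a fixed field $\mathbb K$ of characteristic zero. An action of $\mathfrak g$ on $\mathfrak h$ is a Lie algebra homomorphism $\phi:\mathfrak g\to\mathrm{Der}(\mathfrak h)$. A relative Rota-Baxter operator (of weight $1$) on $\mathfrak g$ with respect to $(\mathfrak h;\phi)$ is a linear map $B:\mathfrak h\to\mathfrak g$ with $[B(u),B(v)]_{\mathfrak g}=B\big(\phi(B(u))v-\phi(B(v))u+[u,v]_{\mathfrak h}\big)$ for all $u,v\in\mathfrak h$. Descendent Lie algebra: $(\mathfrak h,[\cdot,\cdot]_B)$ with $[u,v]_B=\phi(B(u))v-\phi(B(v))u+[u,v]_{\mathfrak h}$. It has a representation $\theta$ on $\mathfrak g$: $\theta(u)x=B(\phi(x)u)+[B(u),x]_{\mathfrak g}$. Cohomology of $B$: $C^k(B)=\mathrm{Hom}(\wedge^{k-1}\mathfrak h,\mathfrak g)$ for $k\ge 1$, with differential $\mathrm d^B_{CE}:C^{k+1}(B)\to C^{k+2}(B)$, for $f\in \mathrm{Hom}(\wedge^{k}\mathfrak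 h,\mathfrak g)$, $$\mathrm d^B_{CE}f(u_1,\dots,u_{k+1})=\sum_{i=1}^{k+1}(-1)^{i+1}\theta(u_i)f(u_1,\dots,\hat u_i,\dots,u_{k+1})+\sum_{i<j}(-1)^{i+j}f([u_i,u_j]_B,u_1,\dots,\hat u_i,\dots,\hat u_j,\dots,u_{k+1}).$$ $H^k(B)$ is the $k$-th cohomology group of $(C^*(B),\mathrm d^B_{CE})$. In particular $2$-cochains are linear maps $\mathfrak h\to\mathfrak g$, and $1$-cochains are elements $x\in\mathfrak g$. A homomorphism from a relative Rota-Baxter operator $B'$ to a relative Rota-Baxter operator $B$ (both on $\mathfrak g$ with respect to $(\mathfrak h;\phi)$) is a pair of Lie algebra homomorphisms $\psi_{\mathfrak g}:\mathfrak g\to\mathfrak g$, $\psi_{\mathfrak h}:\mathfrak h\to\mathfrak h$ with $\psi_{\mathfrak g}\circ B'=B\circ\psi_{\mathfrak h}$ and $\psi_{\mathfrak h}(\phi(x)v)=\phi(\psi_{\mathfrak g}(x))\psi_{\mathfrak h}(v)$ for all $x\in\mathfrak g$, $v\in\mathfrak h$. A linear map $\hat B:\mathfrak h\to\mathfrak g$ generates a one-parameter infinitesimal deformation $B_t=B+t\hat B$ of $B$ if $B_t$ is a relative Rota-Baxter operator on $\mathfrak g$ with respect to $(\mathfrak h;\phi)$ for all $t\in\mathbb K$ (then $\hat B$ is a $2$-cocycle). Two one-parameter infinitesimal deformations $B_t^1$, $B_t^2$ of $B$ are equivalent if there is $x\in\mathfrak g$ such that $(\mathrm{Id}_{\mathfrak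 g}+t\,\mathrm{ad}_x,\ \mathrm{Id}_{\mathfrak h}+t\phi(x))$ is a homomorphism from $B_t^1$ to $B_t^2$ for all $t\in\mathbb K$. *)

theory Defs
  imports Complex_Main "HOL-Algebra.Coset"
begin

text \<open>A Lie algebra has a whole type as its carrier; scalar multiplication and bracket are
  explicit parameters, so that one type may carry several brackets.\<close>

locale lie_algebra = vector_space scale
  for scale :: "'k::field \<Rightarrow> 'a::ab_group_add \<Rightarrow> 'a" +
  fixes bracket :: "'a \<Rightarrow> 'a \<Rightarrow> 'a"
  assumes linear_bracket_left: "Vector_Spaces.linear scale scale (\<lambda>x. bracket x y)"
    and linear_bracket_right: "Vector_Spaces.linear scale scale (\<lambda>y. bracket x y)"
    and bracket_self: "bracket x x = 0"
    and jacobi: "bracket x (bracket y z) + bracket y (bracket z x) + bracket z (bracket x y) = 0"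

definition lie_hom ::
  "('k::field \<Rightarrow> 'a::ab_group_add \<Rightarrow> 'a) \<Rightarrow> ('a \<Rightarrow> 'a \<Rightarrow> 'a) \<Rightarrow>
   ('k \<Rightarrow> 'b::ab_group_add \<Rightarrow> 'b) \<Rightarrow> ('b \<Rightarrow> 'b \<Rightarrow> 'b) \<Rightarrow> ('a \<Rightarrow> 'b) \<Rightarrow> bool" where
  "lie_hom scale_a br_a scale_b br_b f \<longleftrightarrow>
     Vector_Spaces.linear scale_a scale_b f \<and> (\<forall>x y. f (br_a x y) = br_b (f x) (f y))"

definition derivations ::
  "('k::field \<Rightarrow> 'a::ab_group_add \<Rightarrow> 'a) \<Rightarrow> ('a \<Rightarrow> 'a \<Rightarrow> 'a) \<Rightarrow> ('a \<Rightarrow> 'a) set" where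
  "derivations scale br =
     {D. Vector_Spaces.linear scale scale D \<and> (\<forall>x y. D (br x y) = br (D x) y + br x (D y))}"

text \<open>The last two clauses say that \<open>\<phi>\<close> is a Lie algebra homomorphism into the derivations, whose
  vector space structure is pointwise and whose bracket is the commutator.\<close>

definition lie_action ::
  "('k::field \<Rightarrow> 'g::ab_group_add \<Rightarrow> 'g) \<Rightarrow> ('g \<Rightarrow> 'g \<Rightarrow> 'g) \<Rightarrow>
   ('k \<Rightarrow> 'h::ab_group_add \<Rightarrow> 'h) \<Rightarrow> ('h \<Rightarrow> 'h \<Rightarrow> 'h) \<Rightarrow> ('g \<Rightarrow> 'h \<Rightarrow> 'h) \<Rightarrow> bool" where
  "lie_action scale_g br_g scale_h br_h \<phi> \<longleftrightarrow>
     (\<forall>x. \<phi> x \<in> derivations scale_h br_h) \<and>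
     (\<forall>v. Vector_Spaces.linear scale_g scale_h (\<lambda>x. \<phi> x v)) \<and>
     (\<forall>x y v. \<phi> (br_g x y) v = \<phi> x (\<phi> y v) - \<phi> y (\<phi> x v))"

definition descendent_bracket ::
  "('h::ab_group_add \<Rightarrow> 'h \<Rightarrow> 'h) \<Rightarrow> ('g \<Rightarrow> 'h \<Rightarrow> 'h) \<Rightarrow> ('h \<Rightarrow> 'g) \<Rightarrow> 'h \<Rightarrow> 'h \<Rightarrow> 'h" where
  "descendent_bracket br_h \<phi> B u v = \<phi> (B u) v - \<phi> (B v) u + br_h u v"

definition relative_RB_operator ::
  "('k::field \<Rightarrow> 'g::ab_group_add \<Rightarrow> 'g) \<Rightarrow> ('g \<Rightarrow> 'g \<Rightarrow> 'g) \<Rightarrow>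
   ('k \<Rightarrow> 'h::ab_group_add \<Rightarrow> 'h) \<Rightarrow> ('h \<Rightarrow> 'h \<Rightarrow> 'h) \<Rightarrow> ('g \<Rightarrow> 'h \<Rightarrow> 'h) \<Rightarrow> ('h \<Rightarrow> 'g) \<Rightarrow> bool" where
  "relative_RB_operator scale_g br_g scale_h br_h \<phi> B \<longleftrightarrow>
     Vector_Spaces.linear scale_h scale_g B \<and>
     (\<forall>u v. br_g (B u) (B v) = B (\<phi> (B u) v - \<phi> (B v) u + br_h u v))"

definition descendent_rep ::
  "('g::ab_group_add \<Rightarrow> 'g \<Rightarrow> 'g) \<Rightarrow> ('g \<Rightarrow> 'h \<Rightarrow> 'h) \<Rightarrow> ('h \<Rightarrow> 'g) \<Rightarrow> 'h \<Rightarrow> 'g \<Rightarrow> 'g" where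
  "descendent_rep br_g \<phi> B u x = B (\<phi> x u) + br_g (B u) x"

text \<open>An element of \<open>Hom(\<And>\<^sup>n \<hh>, \<gg>)\<close> is an alternating \<open>n\<close>-linear map, encoded as a function on
  argument lists that vanishes on all lists whose length is not \<open>n\<close>; the last condition makes the
  encoding unique.\<close>

definition alternating_maps ::
  "('k::field \<Rightarrow> 'h::ab_group_add \<Rightarrow> 'h) \<Rightarrow> ('k \<Rightarrow> 'g::ab_group_add \<Rightarrow> 'g) \<Rightarrow> nat \<Rightarrow>
   ('h list \<Rightarrow> 'g) set" where
  "alternating_maps scale_h scale_g n =
     {f. (\<forall>us i. length us = n \<and> i < n \<longrightarrow>
            Vector_Spaces.linear scale_h scale_g (\<lambda>u. f (us[i := u]))) \<and>
         (\<forall>us i j. length us = n \<and> i < j \<and> j < n \<and> us ! i = us ! j \<longrightarrow> f us = 0) \<and>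
         (\<forall>us. length us \<noteq> n \<longrightarrow> f us = 0)}"

text \<open>The complex starts in degree 1, i.e. \<open>C\<^sup>0(B) = 0\<close>.\<close>

definition RB_cochains ::
  "('k::field \<Rightarrow> 'h::ab_group_add \<Rightarrow> 'h) \<Rightarrow> ('k \<Rightarrow> 'g::ab_group_add \<Rightarrow> 'g) \<Rightarrow> nat \<Rightarrow>
   ('h list \<Rightarrow> 'g) set" where
  "RB_cochains scale_h scale_g k =
     (if k = 0 then {\<lambda>_. 0} else alternating_maps scale_h scale_g (k - 1))"

text \<open>One formula serves all degrees. Arguments are indexed from 0, so the sign of the \<open>i\<close>-th
  summand of the first sum is \<open>(-1)^i\<close> rather than \<open>(-1)^(i+1)\<close>; \<open>nths us (- I)\<close> omits the
  arguments at the positions in \<open>I\<close>.\<close>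

definition RB_differential ::
  "('k::field \<Rightarrow> 'g::ab_group_add \<Rightarrow> 'g) \<Rightarrow> ('g \<Rightarrow> 'g \<Rightarrow> 'g) \<Rightarrow> ('h::ab_group_add \<Rightarrow> 'h \<Rightarrow> 'h) \<Rightarrow>
   ('g \<Rightarrow> 'h \<Rightarrow> 'h) \<Rightarrow> ('h \<Rightarrow> 'g) \<Rightarrow> ('h list \<Rightarrow> 'g) \<Rightarrow> 'h list \<Rightarrow> 'g" where
  "RB_differential scale_g br_g br_h \<phi> B f us =
     (\<Sum>i<length us.
        scale_g ((-1) ^ i) (descendent_rep br_g \<phi> B (us ! i) (f (nths us (- {i}))))) +
     (\<Sum>j<length us. \<Sum>i<j.
        scale_g ((-1) ^ (i + j))
          (f (descendent_bracket br_h \<phi> B (us ! i) (us ! j) # nths us (- {i, j}))))"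

definition RB_cocycles ::
  "('k::field \<Rightarrow> 'g::ab_group_add \<Rightarrow> 'g) \<Rightarrow> ('g \<Rightarrow> 'g \<Rightarrow> 'g) \<Rightarrow>
   ('k \<Rightarrow> 'h::ab_group_add \<Rightarrow> 'h) \<Rightarrow> ('h \<Rightarrow> 'h \<Rightarrow> 'h) \<Rightarrow> ('g \<Rightarrow> 'h \<Rightarrow> 'h) \<Rightarrow> ('h \<Rightarrow> 'g) \<Rightarrow> nat \<Rightarrow>
   ('h list \<Rightarrow> 'g) set" where
  "RB_cocycles scale_g br_g scale_h br_h \<phi> B k =
     {f \<in> RB_cochains scale_h scale_g k. RB_differential scale_g br_g br_h \<phi> B f = (\<lambda>_. 0)}"

text \<open>For \<open>k = 0\<close> truncated subtraction gives \<open>C\<^sup>0(B) = 0\<close> again, which has the right image.\<close>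

definition RB_coboundaries ::
  "('k::field \<Rightarrow> 'g::ab_group_add \<Rightarrow> 'g) \<Rightarrow> ('g \<Rightarrow> 'g \<Rightarrow> 'g) \<Rightarrow>
   ('k \<Rightarrow> 'h::ab_group_add \<Rightarrow> 'h) \<Rightarrow> ('h \<Rightarrow> 'h \<Rightarrow> 'h) \<Rightarrow> ('g \<Rightarrow> 'h \<Rightarrow> 'h) \<Rightarrow> ('h \<Rightarrow> 'g) \<Rightarrow> nat \<Rightarrow>
   ('h list \<Rightarrow> 'g) set" where
  "RB_coboundaries scale_g br_g scale_h br_h \<phi> B k =
     RB_differential scale_g br_g br_h \<phi> B ` RB_cochains scale_h scale_g (k - 1)"

definition RB_cohomology_group ::
  "('k::field \<Rightarrow> 'g::ab_group_add \<Rightarrow> 'g) \<Rightarrow> ('g \<Rightarrow> 'g \<Rightarrow> 'g) \<Rightarrow>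
   ('k \<Rightarrow> 'h::ab_group_add \<Rightarrow> 'h) \<Rightarrow> ('h \<Rightarrow> 'h \<Rightarrow> 'h) \<Rightarrow> ('g \<Rightarrow> 'h \<Rightarrow> 'h) \<Rightarrow> ('h \<Rightarrow> 'g) \<Rightarrow> nat \<Rightarrow>
   ('h list \<Rightarrow> 'g) set monoid" where
  "RB_cohomology_group scale_g br_g scale_h br_h \<phi> B k =
     \<lparr>carrier = RB_cocycles scale_g br_g scale_h br_h \<phi> B k,
      monoid.mult = (\<lambda>f g us. f us + g us),
      one = (\<lambda>_. 0)\<rparr>
     Mod RB_coboundaries scale_g br_g scale_h br_h \<phi> B k"

text \<open>A map \<open>\<hh> \<Rightarrow> \<gg>\<close> regarded as a 2-cochain.\<close>

definition two_cochain :: "('h \<Rightarrow> 'g::zero) \<Rightarrow> 'h list \<Rightarrow> 'g" where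
  "two_cochain T us = (if length us = 1 then T (hd us) else 0)"

definition RB_hom ::
  "('k::field \<Rightarrow> 'g::ab_group_add \<Rightarrow> 'g) \<Rightarrow> ('g \<Rightarrow> 'g \<Rightarrow> 'g) \<Rightarrow>
   ('k \<Rightarrow> 'h::ab_group_add \<Rightarrow> 'h) \<Rightarrow> ('h \<Rightarrow> 'h \<Rightarrow> 'h) \<Rightarrow> ('g \<Rightarrow> 'h \<Rightarrow> 'h) \<Rightarrow>
   ('h \<Rightarrow> 'g) \<Rightarrow> ('h \<Rightarrow> 'g) \<Rightarrow> ('g \<Rightarrow> 'g) \<Rightarrow> ('h \<Rightarrow> 'h) \<Rightarrow> bool" where
  "RB_hom scale_g br_g scale_h br_h \<phi> B' B \<psi>\<^sub>g \<psi>\<^sub>h \<longleftrightarrow>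
     lie_hom scale_g br_g scale_g br_g \<psi>\<^sub>g \<and>
     lie_hom scale_h br_h scale_h br_h \<psi>\<^sub>h \<and>
     \<psi>\<^sub>g \<circ> B' = B \<circ> \<psi>\<^sub>h \<and>
     (\<forall>x v. \<psi>\<^sub>h (\<phi> x v) = \<phi> (\<psi>\<^sub>g x) (\<psi>\<^sub>h v))"

definition linear_deformation ::
  "('k \<Rightarrow> 'g::ab_group_add \<Rightarrow> 'g) \<Rightarrow> ('h \<Rightarrow> 'g) \<Rightarrow> ('h \<Rightarrow> 'g) \<Rightarrow> 'k \<Rightarrow> 'h \<Rightarrow> 'g" where
  "linear_deformation scale_g B B' t u = B u + scale_g t (B' u)"

definition generates_infinitesimal_deformation ::
  "('k::field \<Rightarrow> 'g::ab_group_add \<Rightarrow> 'g) \<Rightarrow> ('g \<Rightarrow> 'g \<Rightarrow> 'g) \<Rightarrow>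
   ('k \<Rightarrow> 'h::ab_group_add \<Rightarrow> 'h) \<Rightarrow> ('h \<Rightarrow> 'h \<Rightarrow> 'h) \<Rightarrow> ('g \<Rightarrow> 'h \<Rightarrow> 'h) \<Rightarrow>
   ('h \<Rightarrow> 'g) \<Rightarrow> ('h \<Rightarrow> 'g) \<Rightarrow> bool" where
  "generates_infinitesimal_deformation scale_g br_g scale_h br_h \<phi> B B' \<longleftrightarrow>
     Vector_Spaces.linear scale_h scale_g B' \<and>
     (\<forall>t. relative_RB_operator scale_g br_g scale_h br_h \<phi> (linear_deformation scale_g B B' t))"

definition equivalent_deformations ::
  "('k::field \<Rightarrow> 'g::ab_group_add \<Rightarrow> 'g) \<Rightarrow> ('g \<Rightarrow> 'g \<Rightarrow> 'g) \<Rightarrow>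
   ('k \<Rightarrow> 'h::ab_group_add \<Rightarrow> 'h) \<Rightarrow> ('h \<Rightarrow> 'h \<Rightarrow> 'h) \<Rightarrow> ('g \<Rightarrow> 'h \<Rightarrow> 'h) \<Rightarrow>
   ('k \<Rightarrow> 'h \<Rightarrow> 'g) \<Rightarrow> ('k \<Rightarrow> 'h \<Rightarrow> 'g) \<Rightarrow> bool" where
  "equivalent_deformations scale_g br_g scale_h br_h \<phi> D1 D2 \<longleftrightarrow>
     (\<exists>x. \<forall>t. RB_hom scale_g br_g scale_h br_h \<phi> (D1 t) (D2 t)
        (\<lambda>y. y + scale_g t (br_g x y)) (\<lambda>v. v + scale_h t (\<phi> x v)))"

end

theory Submission
  imports Defs
begin

text \<open>Both facts needed about the deformations come from comparing coefficients in the parameter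
  \<open>t\<close>. Being a relative Rota-Baxter operator, and intertwining two of them, are polynomial
  conditions in \<open>t\<close> whose constant terms cancel, so each has the shape \<open>t a + t\<^sup>2 b = 0\<close>; in
  characteristic zero this forces \<open>a = 0\<close> (lemma \<open>linear_coefficient_eq_0\<close>).

  The linear coefficient of the Rota-Baxter equation for \<open>B + t B\<^sub>1\<close> says that \<open>B\<^sub>1\<close> is a 2-cocycle.
  The linear coefficient of the intertwining relation
  \<open>(Id + t ad\<^sub>x) (B + t B\<^sub>1) = (B + t B\<^sub>2) (Id + t \<phi>(x))\<close> is
  \<open>B\<^sub>1 u - B\<^sub>2 u = B (\<phi>(x) u) + [B u, x] = \<theta>(u) x\<close>, and the right-hand side is the differential of
  the 1-cochain \<open>x\<close>. Hence \<open>B\<^sub>2\<close> is \<open>B\<^sub>1\<close> plus the coboundary of \<open>-x\<close>, and the coset of \<open>B\<^sub>1\<close> is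
  a cohomology class containing both.\<close>

lemma linear_coefficient_eq_0:
  fixes scale :: "'k::field_char_0 \<Rightarrow> 'a::ab_group_add \<Rightarrow> 'a"
  assumes "vector_space scale"
    and eq: "\<And>t. scale t a + scale (t * t) b = 0"
  shows "a = 0"
proof -
  interpret vector_space scale by fact
  \<comment> \<open>The values at \<open>1\<close> and \<open>-1\<close> differ by \<open>2 a\<close>.\<close>
  have "a + b = 0" "b - a = 0"
    using eq[of 1] eq[of "-1"] by auto
  then have "scale 2 a = 0"
    using scale_left_distrib[of 1 1 a] by (simp add: algebra_simps eq_neg_iff_add_eq_0)
  then show ?thesis by simp
qed

lemma linear_module_hom: "Vector_Spaces.linear s1 s2 f \<Longrightarrow> module_hom s1 s2 f"
  by (simp add: Vector_Spaces.linear_def)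

lemmas linear_add = module_hom.add[OF linear_module_hom]
lemmas linear_scale = module_hom.scale[OF linear_module_hom]
lemmas linear_zero = module_hom.zero[OF linear_module_hom]
lemmas linear_diff = module_hom.diff[OF linear_module_hom]
lemmas linear_neg = module_hom.neg[OF linear_module_hom]

lemma (in lie_algebra) bracket_antisym: "bracket x y = - bracket y x"
proof -
  have "0 = bracket (x + y) (x + y)"
    by (simp only: bracket_self)
  also have "\<dots> = bracket x x + bracket y x + (bracket x y + bracket y y)"
    by (simp only: linear_add[OF linear_bracket_left] linear_add[OF linear_bracket_right])
  also have "\<dots> = bracket x y + bracket y x"
    by (simp add: bracket_self add.commute)
  finally have "bracket x y + bracket y x = 0" ..
  then show ?thesis
    by (simp add: eq_neg_iff_add_eq_0)
qed

lemma length_nths_Compl: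
  assumes "I \<subseteq> {..<length us}"
  shows "length (nths us (- I)) = length us - card I"
proof -
  have "{k. k < length us \<and> k \<in> - I} = {..<length us} - I" by auto
  then show ?thesis
    using assms by (simp add: length_nths card_Diff_subset finite_subset)
qed

text \<open>An element of \<open>\<gg>\<close> regarded as a 1-cochain, i.e. as a map without arguments.\<close>

definition one_cochain :: "'g::zero \<Rightarrow> 'h list \<Rightarrow> 'g" where
  "one_cochain x us = (if us = [] then x else 0)"

locale relative_RB =
  g: lie_algebra scale_g br_g + h: lie_algebra scale_h br_h
  for scale_g :: "'k::field_char_0 \<Rightarrow> 'g::ab_group_add \<Rightarrow> 'g"
    and br_g :: "'g \<Rightarrow> 'g \<Rightarrow> 'g"
    and scale_h :: "'k \<Rightarrow> 'h::ab_group_add \<Rightarrow> 'h"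
    and br_h :: "'h \<Rightarrow> 'h \<Rightarrow> 'h" +
  fixes \<phi> :: "'g \<Rightarrow> 'h \<Rightarrow> 'h" and B :: "'h \<Rightarrow> 'g"
  assumes action: "lie_action scale_g br_g scale_h br_h \<phi>"
    and RB: "relative_RB_operator scale_g br_g scale_h br_h \<phi> B"
begin

lemma linear_B: "Vector_Spaces.linear scale_h scale_g B"
  using RB by (simp add: relative_RB_operator_def)

lemma linear_action_left: "Vector_Spaces.linear scale_g scale_h (\<lambda>x. \<phi> x v)"
  and linear_action_right: "Vector_Spaces.linear scale_h scale_h (\<lambda>v. \<phi> x v)"
  using action by (auto simp: lie_action_def derivations_def)

lemmas bilinear_add =
  linear_add[OF g.linear_bracket_left] linear_add[OF g.linear_bracket_right]
  linear_add[OF linear_action_left] linear_add[OF linear_action_right]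

lemmas bilinear_scale =
  linear_scale[OF g.linear_bracket_left] linear_scale[OF g.linear_bracket_right]
  linear_scale[OF linear_action_left] linear_scale[OF linear_action_right]

lemma descendent_rep_0: "descendent_rep br_g \<phi> B u 0 = 0"
  by (simp add: descendent_rep_def linear_zero[OF linear_action_left] linear_zero[OF linear_B]
      linear_zero[OF g.linear_bracket_right])

lemma descendent_rep_neg: "descendent_rep br_g \<phi> B u (- x) = - descendent_rep br_g \<phi> B u x"
  by (simp add: descendent_rep_def linear_neg[OF linear_action_left] linear_neg[OF linear_B]
      linear_neg[OF g.linear_bracket_right])

text \<open>The differential of a 1-cochain \<open>x\<close> has no bracket terms, so only the action
  \<open>u \<mapsto> \<theta>(u) x\<close> survives.\<close>

lemma differential_one_cochain:
  "RB_differential scale_g br_g br_h \<phi> B (one_cochain x)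
     = two_cochain (\<lambda>u. descendent_rep br_g \<phi> B u x)"
proof
  fix us :: "'h list"
  show "RB_differential scale_g br_g br_h \<phi> B (one_cochain x) us
     = two_cochain (\<lambda>u. descendent_rep br_g \<phi> B u x) us"
  proof (cases "length us = 1")
    case True
    then obtain u where "us = [u]"
      by (auto simp: length_Suc_conv)
    then show ?thesis
      by (simp add: RB_differential_def two_cochain_def one_cochain_def nths_singleton)
  next
    case False
    \<comment> \<open>Omitting one argument then never leaves the empty list, which is the only list on which
      a 1-cochain can be nonzero.\<close>
    have "one_cochain x (nths us (- {i})) = 0" if "i < length us" for i
    proof -
      have "length (nths us (- {i})) = length us - 1"
        using that by (simp add: length_nths_Compl)
      then have "nths us (- {i}) \<noteq> []"
        using False that by (metis One_nat_def Suc_pred diff_is_0_eq gr_zeroI le_zero_eq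
            length_0_conv not_less0)
      then show ?thesis by (simp add: one_cochain_def)
    qed
    then show ?thesis
      using False
      by (simp add: RB_differential_def two_cochain_def descendent_rep_0)
        (simp add: one_cochain_def)
  qed
qed

lemma differential_two_cochain:
  "RB_differential scale_g br_g br_h \<phi> B (two_cochain T) us =
     (if length us = 2
      then descendent_rep br_g \<phi> B (us ! 0) (T (us ! 1))
           - descendent_rep br_g \<phi> B (us ! 1) (T (us ! 0))
           - T (descendent_bracket br_h \<phi> B (us ! 0) (us ! 1))
      else 0)"
proof (cases "length us = 2")
  case True
  then obtain u v where us: "us = [u, v]"
    by (auto simp: length_Suc_conv numeral_2_eq_2)
  have "nths [u, v] (- {0}) = [v]" "nths [u, v] (- {Suc 0}) = [u]" "nths [u, v] (- {0, Suc 0}) = []"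
    by (simp_all add: nths_Cons)
  then show ?thesis
    by (simp add: us RB_differential_def two_cochain_def lessThan_Suc)
next
  case False
  have 1: "two_cochain T (nths us (- {i})) = 0" if "i < length us" for i
  proof -
    have "length (nths us (- {i})) = length us - 1"
      using that by (simp add: length_nths_Compl)
    moreover have "length us - 1 \<noteq> 1" using False that by linarith
    ultimately show ?thesis by (simp add: two_cochain_def)
  qed
  have 2: "two_cochain T (w # nths us (- {i, j})) = 0" if "j < length us" "i < j" for i j w
  proof -
    have "length (nths us (- {i, j})) = length us - 2"
      using that by (simp add: length_nths_Compl)
    then show ?thesis using False that by (simp add: two_cochain_def)
  qed
  from 1 2 show ?thesis
    using False by (simp add: RB_differential_def descendent_rep_0)
qed

lemma one_cochain_in_cochains: "one_cochain x \<in> RB_cochains scale_h scale_g 1"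
  by (auto simp: RB_cochains_def alternating_maps_def one_cochain_def)

lemma two_cochain_in_cochains:
  assumes "Vector_Spaces.linear scale_h scale_g T"
  shows "two_cochain T \<in> RB_cochains scale_h scale_g 2"
proof -
  have "Vector_Spaces.linear scale_h scale_g (\<lambda>u. two_cochain T (us[i := u]))"
    if "length us = 1" "i < 1" for us :: "'h list" and i
    using that assms by (auto simp: two_cochain_def length_Suc_conv)
  then show ?thesis
    by (auto simp: RB_cochains_def alternating_maps_def two_cochain_def)
qed

text \<open>The cocycle equation is the linear coefficient of the Rota-Baxter equation for \<open>B + t T\<close>;
  the quadratic one says \<open>[T u, T v] = T (\<phi>(T u) v - \<phi>(T v) u)\<close>.\<close>

lemma infinitesimal_deformation_cocycle:
  assumes "generates_infinitesimal_deformation scale_g br_g scale_h br_h \<phi> B T"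
  shows "two_cochain T \<in> RB_cocycles scale_g br_g scale_h br_h \<phi> B 2"
proof -
  have linear_T: "Vector_Spaces.linear scale_h scale_g T"
    and RB_t: "relative_RB_operator scale_g br_g scale_h br_h \<phi> (linear_deformation scale_g B T t)"
    for t
    using assms by (auto simp: generates_infinitesimal_deformation_def)
  have "descendent_rep br_g \<phi> B u (T v) - descendent_rep br_g \<phi> B v (T u)
      - T (descendent_bracket br_h \<phi> B u v) = 0" (is "?a = 0") for u v
  proof (rule linear_coefficient_eq_0[OF g.vector_space_axioms])
    fix t
    let ?B = "\<lambda>u. B u + scale_g t (T u)"
    let ?b = "br_g (T u) (T v) - T (\<phi> (T u) v - \<phi> (T v) u)"
    have B: "br_g (B u) (B v) = B (\<phi> (B u) v - \<phi> (B v) u + br_h u v)"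
      using RB by (simp add: relative_RB_operator_def)
    have "br_g (?B u) (?B v) = ?B (\<phi> (?B u) v - \<phi> (?B v) u + br_h u v)"
      using RB_t[of t] by (simp add: relative_RB_operator_def linear_deformation_def)
    then show "scale_g t ?a + scale_g (t * t) ?b = 0"
      using B g.bracket_antisym[of "T u" "B v"]
      by (simp add: descendent_rep_def descendent_bracket_def bilinear_add bilinear_scale
          linear_add[OF linear_B] linear_diff[OF linear_B] linear_scale[OF linear_B]
          linear_add[OF linear_T] linear_diff[OF linear_T] linear_scale[OF linear_T]
          g.scale_right_distrib g.scale_right_diff_distrib algebra_simps)
  qed
  then show ?thesis
    using two_cochain_in_cochains[OF linear_T]
    by (auto simp: RB_cocycles_def differential_two_cochain)
qed

text \<open>The linear coefficient of the intertwining relation between the two deformations; its other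
  coefficient is \<open>[x, T1 u] = T2 (\<phi>(x) u)\<close>.\<close>

lemma equivalent_deformations_differ_by_rep:
  assumes linear_T2: "Vector_Spaces.linear scale_h scale_g T2"
    and "equivalent_deformations scale_g br_g scale_h br_h \<phi>
           (linear_deformation scale_g B T1) (linear_deformation scale_g B T2)"
  shows "\<exists>x. \<forall>u. T1 u = T2 u + descendent_rep br_g \<phi> B u x"
proof -
  obtain x where hom: "\<And>t. RB_hom scale_g br_g scale_h br_h \<phi>
      (linear_deformation scale_g B T1 t) (linear_deformation scale_g B T2 t)
      (\<lambda>y. y + scale_g t (br_g x y)) (\<lambda>v. v + scale_h t (\<phi> x v))"
    using assms(2) by (auto simp: equivalent_deformations_def)
  have "T1 u - T2 u - descendent_rep br_g \<phi> B u x = 0" (is "?a = 0") for u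
  proof (rule linear_coefficient_eq_0[OF g.vector_space_axioms])
    fix t
    let ?b = "br_g x (T1 u) - T2 (\<phi> x u)"
    let ?lhs = "(B u + scale_g t (T1 u)) + scale_g t (br_g x (B u + scale_g t (T1 u)))"
    let ?rhs = "B (u + scale_h t (\<phi> x u)) + scale_g t (T2 (u + scale_h t (\<phi> x u)))"
    have "scale_g t ?a + scale_g (t * t) ?b = ?lhs - ?rhs"
      by (simp add: g.bracket_antisym[of "B u" x] descendent_rep_def bilinear_add bilinear_scale
          linear_add[OF linear_B] linear_scale[OF linear_B]
          linear_add[OF linear_T2] linear_scale[OF linear_T2]
          g.scale_right_distrib g.scale_right_diff_distrib)
    also have "?lhs = ?rhs"
      using hom[of t] by (simp add: RB_hom_def linear_deformation_def fun_eq_iff)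
    finally show "scale_g t ?a + scale_g (t * t) ?b = 0" by simp
  qed
  then have "T1 u = T2 u + descendent_rep br_g \<phi> B u x" for u
    by (simp only: diff_diff_eq right_minus_eq)
  then show ?thesis by (intro exI allI)
qed

lemma cocycle_coset_is_class:
  assumes "f \<in> RB_cocycles scale_g br_g scale_h br_h \<phi> B k"
  shows "{\<lambda>us. b us + f us | b. b \<in> RB_coboundaries scale_g br_g scale_h br_h \<phi> B k}
           \<in> carrier (RB_cohomology_group scale_g br_g scale_h br_h \<phi> B k)"
  using assms
  by (auto simp: RB_cohomology_group_def FactGroup_def RCOSETS_def r_coset_def)

lemma descendent_rep_coboundary:
  "two_cochain (\<lambda>u. descendent_rep br_g \<phi> B u x) \<in> RB_coboundaries scale_g br_g scale_h br_h \<phi> B 2"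
  using imageI[OF one_cochain_in_cochains, of "RB_differential scale_g br_g br_h \<phi> B" x]
  by (simp add: RB_coboundaries_def differential_one_cochain)

end

theorem theorem2p16:
  fixes scale_g :: "'k::field_char_0 \<Rightarrow> 'g::ab_group_add \<Rightarrow> 'g"
    and br_g :: "'g \<Rightarrow> 'g \<Rightarrow> 'g"
    and scale_h :: "'k \<Rightarrow> 'h::ab_group_add \<Rightarrow> 'h"
    and br_h :: "'h \<Rightarrow> 'h \<Rightarrow> 'h"
    and \<phi> :: "'g \<Rightarrow> 'h \<Rightarrow> 'h"
    and B B1 B2 :: "'h \<Rightarrow> 'g"
  assumes "lie_algebra scale_g br_g"
    and "lie_algebra scale_h br_h"
    and "lie_action scale_g br_g scale_h br_h \<phi>"
    and "relative_RB_operator scale_g br_g scale_h br_h \<phi> B"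
    and "generates_infinitesimal_deformation scale_g br_g scale_h br_h \<phi> B B1"
    and "generates_infinitesimal_deformation scale_g br_g scale_h br_h \<phi> B B2"
    and "equivalent_deformations scale_g br_g scale_h br_h \<phi>
           (linear_deformation scale_g B B1) (linear_deformation scale_g B B2)"
  shows "\<exists>c \<in> carrier (RB_cohomology_group scale_g br_g scale_h br_h \<phi> B 2).
           two_cochain B1 \<in> c \<and> two_cochain B2 \<in> c"
proof -
  interpret relative_RB scale_g br_g scale_h br_h \<phi> B
    using assms(1-4) by (simp add: relative_RB_def relative_RB_axioms_def)
  let ?\<theta> = "descendent_rep br_g \<phi> B"
  let ?c = "{\<lambda>us. b us + two_cochain B1 us | b.
               b \<in> RB_coboundaries scale_g br_g scale_h br_h \<phi> B 2}"
  have "Vector_Spaces.linear scale_h scale_g B2"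
    using assms(6) by (simp add: generates_infinitesimal_deformation_def)
  from equivalent_deformations_differ_by_rep[OF this assms(7)]
  obtain x where x: "\<forall>u. B1 u = B2 u + ?\<theta> u x" ..
  have "two_cochain B1 = (\<lambda>us. two_cochain (\<lambda>u. ?\<theta> u 0) us + two_cochain B1 us)"
    by (simp add: fun_eq_iff two_cochain_def descendent_rep_0)
  then have "two_cochain B1 \<in> ?c"
    using descendent_rep_coboundary[of 0] by (intro CollectI exI conjI)
  moreover have "two_cochain B2 = (\<lambda>us. two_cochain (\<lambda>u. ?\<theta> u (- x)) us + two_cochain B1 us)"
    by (simp add: fun_eq_iff two_cochain_def x descendent_rep_neg)
  then have "two_cochain B2 \<in> ?c"
    using descendent_rep_coboundary[of "- x"] by (intro CollectI exI conjI)
  moreover have "?c \<in> carrier (RB_cohomology_group scale_g br_g scale_h br_h \<phi> B 2)"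
    by (rule cocycle_coset_is_class[OF infinitesimal_deformation_cocycle[OF assms(5)]])
  ultimately show ?thesis by (intro bexI conjI)
qed

end
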